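(* Suppose that the function $W:\mathbb R^m\to\mathbb R$ is radially strictly convex and smooth, and let $$I(u)=\int_0^1W(u'(t))\,dt$$ for curves $u:[0,1]\to\mathbb R^m$. Then, for every smooth regular curve $u$ (i.e. $u'(t)\neq 0$ for all $t$), the invariant realization $I_i$ of $I$ is given by $$I_i(u)=\int_0^1 f(c(u),u'(t))\,W\left(\frac1{f(c(u),u'(t))}u'(t)\right)dt,$$ where, for fixed $x$, the function $c\mapsto f(c,x)$ is the inverse of $$r\in(0,\infty)\mapsto g(r,x)= W\left(\frac1r x\right)-\frac1r\nabla W\left(\frac1r x\right)\cdot x,$$ and the number $c=c(u)$, constant with respect to $t$, is determined through the condition $$\int_0^1 f(c(u),u'(t))\,dt=1.$$
   Context: A continuous function $W:\mathbb R^m\to\mathbb R$ is said to be radially strictly convex and smooth if for every $x\in\mathbb R^m\setminus\{0\}$ the section $r\in(0,\infty)\mapsto r\,W\left(\frac1r x\right)$ is a strictly convex and smooth function of the single variable $r$. (The function $g(\cdot,x)$ in the claim is the first derivative of this section.) The invariant realization of $I$ is $$I_i(u)=\inf_{\phi}I(u_\phi)=\inf_\phi\int_0^1\phi'(t)\,W\left(\frac1{\phi'(t)}u'(t)\right)dt,\quad u_\phi(s)=u(\phi^{-1}(s)),$$ the infimum being taken over all smooth changes of variables $\phi:[0,1]\to[0,1]$ with $\phi(0)=0$, $\phi(1)=1$, $\phi'>0$.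
   Formalization: A number c(u) satisfying the integral condition need not exist for every such W and u; existence is proved when the domain of f(·,u'(t)) is the same for all t, and uniqueness of c(u) and the formula for I_i(u) are proved whenever some such c exists. *)

theory Defs
  imports "HOL-Analysis.Analysis"
begin

text \<open>
  \<open>f\<close> is \<open>C\<^sup>\<infinity>\<close> on \<open>S\<close>: the function \<open>D n\<close> is the \<open>n\<close>-th derivative. Derivatives are taken within
  \<open>S\<close>, hence one-sided at the endpoints of a compact interval, and values of \<open>f\<close> off \<open>S\<close> are
  irrelevant.
\<close>
definition smooth_on :: "real set \<Rightarrow> (real \<Rightarrow> 'a::real_normed_vector) \<Rightarrow> bool" where
  "smooth_on S f \<longleftrightarrow>
    (\<exists>D. (\<forall>t\<in>S. D 0 t = f t) \<and>
         (\<forall>n. \<forall>t\<in>S. (D n has_vector_derivative D (Suc n) t) (at t within S)))"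

definition strictly_convex_on :: "real set \<Rightarrow> (real \<Rightarrow> real) \<Rightarrow> bool" where
  "strictly_convex_on S F \<longleftrightarrow> convex S \<and>
    (\<forall>r\<in>S. \<forall>s\<in>S. \<forall>a. r \<noteq> s \<longrightarrow> 0 < a \<longrightarrow> a < 1 \<longrightarrow>
       F ((1 - a) * r + a * s) < (1 - a) * F r + a * F s)"

definition radial_section :: "(real ^ 'm \<Rightarrow> real) \<Rightarrow> real ^ 'm \<Rightarrow> real \<Rightarrow> real" where
  "radial_section W x r = r * W ((1 / r) *\<^sub>R x)"

definition radially_strictly_convex_smooth :: "(real ^ 'm \<Rightarrow> real) \<Rightarrow> bool" where
  "radially_strictly_convex_smooth W \<longleftrightarrow>
    continuous_on UNIV W \<and>
    (\<forall>x. x \<noteq> 0 \<longrightarrow>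
       strictly_convex_on {0<..} (radial_section W x) \<and> smooth_on {0<..} (radial_section W x))"

text \<open>
  \<open>\<nabla>W(y) \<cdot> v\<close>, read as the derivative of \<open>W\<close> at \<open>y\<close> along \<open>v\<close>. Radial smoothness provides it only
  for \<open>v\<close> parallel to \<open>y \<noteq> 0\<close>, and \<open>W\<close> need not be differentiable; where \<open>W\<close> has a gradient the two
  agree (\<open>grad_dot_gradient\<close>).
\<close>
definition grad_dot :: "(real ^ 'm \<Rightarrow> real) \<Rightarrow> real ^ 'm \<Rightarrow> real ^ 'm \<Rightarrow> real" where
  "grad_dot W y v = deriv (\<lambda>h. W (y + h *\<^sub>R v)) 0"

definition g_map :: "(real ^ 'm \<Rightarrow> real) \<Rightarrow> real \<Rightarrow> real ^ 'm \<Rightarrow> real" where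
  "g_map W r x = W ((1 / r) *\<^sub>R x) - (1 / r) * grad_dot W ((1 / r) *\<^sub>R x) x"

text \<open>The domain of the inverse \<open>f(\<cdot>, x)\<close>; off it the value of \<open>f_map\<close> is meaningless.\<close>
definition f_domain :: "(real ^ 'm \<Rightarrow> real) \<Rightarrow> real ^ 'm \<Rightarrow> real set" where
  "f_domain W x = (\<lambda>r. g_map W r x) ` {0<..}"

definition f_map :: "(real ^ 'm \<Rightarrow> real) \<Rightarrow> real \<Rightarrow> real ^ 'm \<Rightarrow> real" where
  "f_map W c x = inv_into {0<..} (\<lambda>r. g_map W r x) c"

abbreviation velocity :: "(real \<Rightarrow> 'a::real_normed_vector) \<Rightarrow> real \<Rightarrow> 'a" where
  "velocity u t \<equiv> vector_derivative u (at t within {0..1})"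

definition smooth_regular_curve :: "(real \<Rightarrow> real ^ 'm) \<Rightarrow> bool" where
  "smooth_regular_curve u \<longleftrightarrow> smooth_on {0..1} u \<and> (\<forall>t\<in>{0..1}. velocity u t \<noteq> 0)"

definition functional_I :: "(real ^ 'm \<Rightarrow> real) \<Rightarrow> (real \<Rightarrow> real ^ 'm) \<Rightarrow> real" where
  "functional_I W u = integral {0..1} (\<lambda>t. W (velocity u t))"

definition changes_of_variables :: "(real \<Rightarrow> real) set" where
  "changes_of_variables =
    {\<phi>. smooth_on {0..1} \<phi> \<and> \<phi> ` {0..1} \<subseteq> {0..1} \<and> \<phi> 0 = 0 \<and> \<phi> 1 = 1 \<and>
        (\<forall>t\<in>{0..1}. velocity \<phi> t > 0)}"

definition reparametrized :: "(real \<Rightarrow> real ^ 'm) \<Rightarrow> (real \<Rightarrow> real) \<Rightarrow> real \<Rightarrow> real ^ 'm" where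
  "reparametrized u \<phi> s = u (inv_into {0..1} \<phi> s)"

text \<open>The infimum is taken in the extended reals, so that it is meaningful without a lower bound.\<close>
definition invariant_realization :: "(real ^ 'm \<Rightarrow> real) \<Rightarrow> (real \<Rightarrow> real ^ 'm) \<Rightarrow> ereal" where
  "invariant_realization W u =
    (INF \<phi>\<in>changes_of_variables. ereal (functional_I W (reparametrized u \<phi>)))"

text \<open>
  The condition determining \<open>c(u)\<close>. It includes that \<open>f(c, u'(t))\<close> makes sense for every \<open>t\<close>, that
  is, that \<open>c\<close> lies in the domain of each of the inverses involved. If these domains vary with \<open>t\<close>,
  the condition can be unsolvable: for \<open>W(x) = a(x/|x|) (sqrt(1 + |x|^2) - 1)\<close> with \<open>a > 0\<close>
  nonconstant, the domain is \<open>(-a(x/|x|), 0)\<close>, and no \<open>c\<close> works for long curves along which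
  \<open>a\<close> varies.
\<close>
definition c_condition :: "(real ^ 'm \<Rightarrow> real) \<Rightarrow> (real \<Rightarrow> real ^ 'm) \<Rightarrow> real \<Rightarrow> bool" where
  "c_condition W u c \<longleftrightarrow>
    (\<forall>t\<in>{0..1}. c \<in> f_domain W (velocity u t)) \<and>
    ((\<lambda>t. f_map W c (velocity u t)) has_integral 1) {0..1}"

definition c_of :: "(real ^ 'm \<Rightarrow> real) \<Rightarrow> (real \<Rightarrow> real ^ 'm) \<Rightarrow> real" where
  "c_of W u = (THE c. c_condition W u c)"

lemma grad_dot_gradient:
  assumes "GDERIV W y :> D"
  shows "grad_dot W y v = D \<bullet> v"
proof -
  have "(W has_derivative (\<lambda>h. h \<bullet> D)) (at (y + 0 *\<^sub>R v))"
    using assms by (simp add: gderiv_def)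
  moreover have "((\<lambda>h. y + h *\<^sub>R v) has_derivative (\<lambda>h. h *\<^sub>R v)) (at (0::real))"
    by (auto intro!: derivative_eq_intros)
  ultimately have "((\<lambda>h. W (y + h *\<^sub>R v)) has_derivative (\<lambda>h. (h *\<^sub>R v) \<bullet> D)) (at 0)"
    using has_derivative_compose[of "\<lambda>h. y + h *\<^sub>R v" _ 0 UNIV W] by blast
  then have "((\<lambda>h. W (y + h *\<^sub>R v)) has_real_derivative D \<bullet> v) (at 0)"
    by (simp add: has_field_derivative_def mult.commute[of _ "D \<bullet> v"] inner_commute)
  then show ?thesis
    unfolding grad_dot_def by (rule DERIV_imp_deriv)
qed

lemma g_map_is_derivative_of_section:
  assumes W: "radially_strictly_convex_smooth W" and x: "x \<noteq> 0" and r: "r > 0"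
  shows "(radial_section W x has_real_derivative g_map W r x) (at r)"
proof -
  obtain D where D0: "\<And>t. t > 0 \<Longrightarrow> D 0 t = radial_section W x t"
    and D: "\<And>n t. t > 0 \<Longrightarrow> (D n has_vector_derivative D (Suc n) t) (at t within {0<..})"
    using W x unfolding radially_strictly_convex_smooth_def smooth_on_def
    by (metis greaterThan_iff)
  have "(D 0 has_real_derivative D 1 r) (at r)"
    using D[of r 0] r
    by (simp add: at_within_open[of r "{0<..}"] has_real_derivative_iff_has_vector_derivative)
  then have S: "(radial_section W x has_real_derivative D 1 r) (at r)"
    by (rule DERIV_cong_ev[THEN iffD1, rotated -1])
       (use r D0 in \<open>auto simp: eventually_nhds intro!: exI[of _ "{0<..}"]\<close>)
  define k where "k = (\<lambda>h. 1 / (1 / r + h))"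
  have k: "(k has_real_derivative - (r^2)) (at 0)"
    unfolding k_def using r
    by (auto intro!: derivative_eq_intros simp: power2_eq_square field_simps)
  have "((\<lambda>h. radial_section W x (k h)) has_real_derivative D 1 r * (- (r^2))) (at 0)"
    by (rule DERIV_chain2[OF _ k]) (use S in \<open>simp add: k_def\<close>)
  then have "((\<lambda>h. (1 / r + h) * radial_section W x (k h)) has_real_derivative
      1 * radial_section W x (k 0) + (D 1 r * (- (r^2))) * (1 / r + 0)) (at 0)"
    by (intro DERIV_mult) (auto intro!: derivative_eq_intros)
  then have "((\<lambda>h. (1 / r + h) * radial_section W x (k h)) has_real_derivative
      radial_section W x r - r * D 1 r) (at 0)"
    using r by (simp add: k_def power2_eq_square mult.commute)
  moreover have "\<forall>\<^sub>F h in nhds 0. (1 / r + h) * radial_section W x (k h) =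
      W ((1 / r) *\<^sub>R x + h *\<^sub>R x)"
    unfolding eventually_nhds
    by (rule exI[of _ "{- (1 / r)<..}"])
       (use r in \<open>auto simp: radial_section_def k_def scaleR_add_left\<close>)
  ultimately have "((\<lambda>h. W ((1 / r) *\<^sub>R x + h *\<^sub>R x)) has_real_derivative
      radial_section W x r - r * D 1 r) (at 0)"
    by (rule DERIV_cong_ev[OF refl _ refl, THEN iffD1, rotated])
  then have "grad_dot W ((1 / r) *\<^sub>R x) x = radial_section W x r - r * D 1 r"
    unfolding grad_dot_def by (rule DERIV_imp_deriv)
  then have "g_map W r x = D 1 r"
    using r by (simp add: g_map_def radial_section_def field_simps)
  with S show ?thesis by simp
qed

end

theory Submission
  imports Defs
begin

text \<open>
  Write \<open>F\<^sub>t(r) = r W(u'(t) / r)\<close> for the section of \<open>W\<close> along the velocity at time \<open>t\<close>. Substituting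
  \<open>s = \<phi>(t)\<close> in \<open>I(u\<^sub>\<phi>)\<close> turns it into \<open>\<integral> F\<^sub>t(\<phi>'(t)) dt\<close> (\<open>functional_I_reparametrized\<close>), so that \<open>\<phi>\<close>
  enters only through its derivative: the problem is to minimize the strictly convex functional
  \<open>p \<mapsto> \<integral> F\<^sub>t(p(t)) dt\<close> over positive densities \<open>p\<close> of total mass one. The constraint contributes one
  Lagrange multiplier \<open>c\<close>, and the stationarity condition \<open>F\<^sub>t'(p(t)) = c\<close> is solved by
  \<open>f(t) = f(c, u'(t))\<close>, since \<open>g(\<cdot>, u'(t)) = F\<^sub>t'\<close>.

  Stationarity gives the lower bound: the tangent of \<open>F\<^sub>t\<close> at \<open>f(t)\<close> has slope \<open>c\<close> for every \<open>t\<close>, so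
  \<open>F\<^sub>t(p(t)) \<ge> F\<^sub>t(f(t)) + c (p(t) - f(t))\<close>, and the last term integrates to zero because both
  densities have mass one (\<open>unit_level_minimizes\<close>).

  The bound need not be attained: \<open>W\<close> is smooth only along rays, so \<open>f\<close> is merely continuous and
  its primitive need not be a smooth change of variables. It is sharp nevertheless, because \<open>f\<close> is a
  uniform limit of positive polynomials of mass one, whose primitives are smooth changes of
  variables (\<open>polynomial_density_approximates\<close>, \<open>change_of_variables_from_density\<close>).

  What remains is the dependence on \<open>t\<close> and \<open>c\<close>. For convex functions, continuity of \<open>F\<^sub>t(r)\<close> in
  \<open>(r, t)\<close> passes to the derivative (\<open>G_continuous\<close>) and from there to its inverse
  (\<open>G_inverse_continuous\<close>). The inverse is strictly increasing in \<open>c\<close>, hence so is its integral, which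
  makes \<open>c\<close> unique. If all the domains agree, two levels at which the inverse stays below and above
  one are at hand, and the intermediate value theorem provides \<open>c\<close> (\<open>unit_level_exists\<close>).
\<close>

section \<open>Families of strictly convex functions\<close>

text \<open>
  The situation stripped of \<open>W\<close> and \<open>u\<close>: strictly convex functions \<open>F t\<close> on the positive half-line
  with derivatives \<open>G t\<close>, depending continuously on the parameter \<open>t\<close>.
\<close>
locale strictly_convex_family =
  fixes F G :: "'a::topological_space \<Rightarrow> real \<Rightarrow> real" and T :: "'a set"
  assumes F_continuous: "continuous_on ({0<..} \<times> T) (\<lambda>(r, t). F t r)"
    and F_deriv: "\<And>t r. t \<in> T \<Longrightarrow> 0 < r \<Longrightarrow> (F t has_real_derivative G t r) (at r)"
    and F_strictly_convex: "\<And>t. t \<in> T \<Longrightarrow> strictly_convex_on {0<..} (F t)"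
begin

lemma F_compose_continuous:
  assumes "continuous_on U a" "continuous_on U b" "\<And>z. z \<in> U \<Longrightarrow> 0 < a z" "\<And>z. z \<in> U \<Longrightarrow> b z \<in> T"
  shows "continuous_on U (\<lambda>z. F (b z) (a z))"
  by (rule continuous_on_compose_Pair[OF F_continuous assms(1,2)]) (use assms(3,4) in auto)

lemma F_convex:
  assumes t: "t \<in> T"
  shows "convex_on {0<..} (F t)"
proof (rule convex_onI)
  fix a x y :: real
  assume "0 < a" "a < 1" "x \<in> {0<..}" "y \<in> {0<..}"
  then show "F t ((1 - a) *\<^sub>R x + a *\<^sub>R y) \<le> (1 - a) * F t x + a * F t y"
    using F_strictly_convex[OF t] unfolding strictly_convex_on_def
    by (cases "x = y") (force simp: algebra_simps)+
qed simp

lemma above_tangent: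
  assumes "t \<in> T" "0 < r" "0 < s"
  shows "F t r + G t r * (s - r) \<le> F t s"
proof -
  have "G t r * (s - r) \<le> F t s - F t r"
    by (rule convex_on_imp_above_tangent[OF F_convex, of t r])
       (use assms F_deriv in \<open>auto simp: interior_open intro: has_field_derivative_at_within\<close>)
  then show ?thesis by simp
qed

text \<open>
  The tangent at \<open>r\<close> already bounds \<open>F t\<close> from below at the midpoint of \<open>r\<close> and \<open>s\<close>, where strict
  convexity puts the chord strictly above \<open>F t\<close>.
\<close>
lemma strictly_above_tangent:
  assumes t: "t \<in> T" and r: "0 < r" and s: "0 < s" and "r \<noteq> s"
  shows "F t r + G t r * (s - r) < F t s"
proof -
  have "F t r + G t r * ((r + s) / 2 - r) \<le> F t ((r + s) / 2)"
    using assms by (intro above_tangent) auto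
  moreover have "F t ((1 - 1/2) * r + 1/2 * s) < (1 - 1/2) * F t r + 1/2 * F t s"
    using F_strictly_convex[OF t, unfolded strictly_convex_on_def, THEN conjunct2,
        rule_format, of r s "1/2"] r s \<open>r \<noteq> s\<close>
    by simp
  ultimately show ?thesis by (simp add: field_simps)
qed

lemma G_strict_mono:
  assumes "t \<in> T" "0 < r" "r < s"
  shows "G t r < G t s"
proof -
  have "F t r + G t r * (s - r) < F t s" "F t s + G t s * (r - s) < F t r"
    using assms strictly_above_tangent[of t r s] strictly_above_tangent[of t s r] by auto
  then have "0 < (G t s - G t r) * (s - r)" by (simp add: algebra_simps)
  with \<open>r < s\<close> show ?thesis by (simp add: zero_less_mult_iff)
qed

lemma G_less_iff:
  assumes "t \<in> T" "0 < r" "0 < s"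
  shows "G t r < G t s \<longleftrightarrow> r < s"
  using G_strict_mono[of t r s] G_strict_mono[of t s r] assms by (cases r s rule: linorder_cases) auto

text \<open>
  Difference quotients over a multiplicative step \<open>r \<mapsto> k r\<close>. With an additive step the left
  neighbour would leave the half-line for small \<open>r\<close>; this form is defined, and continuous in
  \<open>(r, t)\<close>, on the whole domain.
\<close>
definition slope :: "real \<Rightarrow> real \<times> 'a \<Rightarrow> real" where
  "slope k = (\<lambda>(r, t). (F t (k * r) - F t r) / ((k - 1) * r))"

lemma slope_continuous:
  assumes "0 < k" "k \<noteq> 1"
  shows "continuous_on ({0<..} \<times> T) (slope k)"
  unfolding slope_def split_def
  using assms by (intro continuous_intros F_compose_continuous) auto

lemma slope_le_G:
  assumes "t \<in> T" "0 < r" "0 < k" "k < 1"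
  shows "slope k (r, t) \<le> G t r"
  using above_tangent[of t r "k * r"] assms
  by (simp add: slope_def divide_le_eq mult_less_0_iff algebra_simps)

lemma G_le_slope:
  assumes "t \<in> T" "0 < r" "1 < k"
  shows "G t r \<le> slope k (r, t)"
  using above_tangent[of t r "k * r"] assms
  by (simp add: slope_def le_divide_eq zero_less_mult_iff algebra_simps)

lemma slope_tendsto:
  assumes "t \<in> T" "0 < r"
  shows "((\<lambda>k. slope k (r, t)) \<longlongrightarrow> G t r) (at 1)"
proof -
  have "((\<lambda>k. F t (k * r)) has_real_derivative G t r * r) (at 1)"
    by (rule DERIV_chain2[where f = "F t"])
       (use F_deriv[of t "1 * r"] assms in \<open>auto intro!: derivative_eq_intros\<close>)
  then have "((\<lambda>k. (F t (k * r) - F t (1 * r)) / (k - 1) / r) \<longlongrightarrow> G t r * r / r) (at 1)"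
    unfolding has_field_derivative_iff using assms by (intro tendsto_intros) auto
  then show ?thesis using assms by (simp add: slope_def)
qed

text \<open>
  Difference quotients to the left bound \<open>G\<close> from below and those to the right from above. Each of
  them is continuous in \<open>(r, t)\<close>, and they approximate \<open>G\<close> at a given point arbitrarily well. So \<open>G\<close> is
  both lower and upper semicontinuous.
\<close>
lemma G_continuous: "continuous_on ({0<..} \<times> T) (\<lambda>(r, t). G t r)"
  unfolding continuous_on_def
proof
  fix z
  assume "z \<in> {0::real<..} \<times> T"
  then obtain r t where z: "z = (r, t)" and r: "0 < r" and t: "t \<in> T"
    by auto
  let ?at = "at (r, t) within {0<..} \<times> T"
  have in_dom: "\<forall>\<^sub>F z in ?at. z \<in> {0<..} \<times> T"
    by (simp add: eventually_at_filter)
  have slope_at: "(slope k \<longlongrightarrow> slope k (r, t)) ?at" if "0 < k" "k \<noteq> 1" for k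
    by (rule bspec[OF slope_continuous[OF that, unfolded continuous_on_def]]) (use r t in simp)
  have near_1: "((\<lambda>k. slope k (r, t)) \<longlongrightarrow> G t r) (at 1 within A)" for A
    by (rule tendsto_within_subset[OF slope_tendsto subset_UNIV]) (use r t in auto)
  have "((\<lambda>(r, t). G t r) \<longlongrightarrow> G t r) ?at"
  proof (rule order_tendstoI)
    fix a assume "a < G t r"
    then have "\<forall>\<^sub>F k in at_left 1. a < slope k (r, t) \<and> k \<in> {0<..<1}"
      by (intro eventually_conj order_tendstoD(1)[OF near_1] eventually_at_left_real) auto
    then have "\<exists>k. a < slope k (r, t) \<and> k \<in> {0<..<1}"
      by (rule eventually_happens'[OF trivial_limit_at_left_real])
    then obtain k where k: "0 < k" "k < 1" "a < slope k (r, t)"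
      by auto
    have "\<forall>\<^sub>F z in ?at. a < slope k z"
      by (rule order_tendstoD(1)[OF slope_at]) (use k in auto)
    with in_dom show "\<forall>\<^sub>F z in ?at. a < (\<lambda>(r, t). G t r) z"
    proof eventually_elim
      case (elim z)
      then show ?case using slope_le_G[of "snd z" "fst z" k] k by (cases z) auto
    qed
  next
    fix a assume "G t r < a"
    then have "\<forall>\<^sub>F k in at_right 1. slope k (r, t) < a \<and> k \<in> {1<..<2}"
      by (intro eventually_conj order_tendstoD(2)[OF near_1] eventually_at_right_real) auto
    then have "\<exists>k. slope k (r, t) < a \<and> k \<in> {1<..<2}"
      by (rule eventually_happens'[OF trivial_limit_at_right_real])
    then obtain k where k: "1 < k" "slope k (r, t) < a"
      by auto
    have "\<forall>\<^sub>F z in ?at. slope k z < a"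
      by (rule order_tendstoD(2)[OF slope_at]) (use k in auto)
    with in_dom show "\<forall>\<^sub>F z in ?at. (\<lambda>(r, t). G t r) z < a"
    proof eventually_elim
      case (elim z)
      then show ?case using G_le_slope[of "snd z" "fst z" k] k by (cases z) auto
    qed
  qed
  then show "((\<lambda>(r, t). G t r) \<longlongrightarrow> (\<lambda>(r, t). G t r) z) (at z within {0<..} \<times> T)"
    by (simp add: z)
qed

lemma G_compose_continuous:
  assumes "continuous_on U a" "continuous_on U b" "\<And>z. z \<in> U \<Longrightarrow> 0 < a z" "\<And>z. z \<in> U \<Longrightarrow> b z \<in> T"
  shows "continuous_on U (\<lambda>z. G (b z) (a z))"
  by (rule continuous_on_compose_Pair[OF G_continuous assms(1,2)]) (use assms(3,4) in auto)

definition G_range :: "'a \<Rightarrow> real set" where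
  "G_range t = G t ` {0<..}"

definition G_inverse :: "real \<Rightarrow> 'a \<Rightarrow> real" where
  "G_inverse c t = inv_into {0<..} (G t) c"

lemma G_inverse:
  assumes "c \<in> G_range t"
  shows G_inverse_pos: "0 < G_inverse c t" and G_G_inverse: "G t (G_inverse c t) = c"
  using assms inv_into_into[of c "G t" "{0<..}"] f_inv_into_f[of c "G t" "{0<..}"]
  by (auto simp: G_range_def G_inverse_def)

text \<open>
  \<open>G t\<close> is continuous on a connected set, so its range has no gaps.
\<close>
lemma G_range_interval:
  assumes t: "t \<in> T" and a: "a \<in> G_range t" and b: "b \<in> G_range t" and "a \<le> c" "c \<le> b"
  shows "c \<in> G_range t"
proof -
  have "continuous_on {0<..} (G t)"
    using t by (intro G_compose_continuous continuous_intros) auto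
  then have "connected (G_range t)"
    unfolding G_range_def by (intro connected_continuous_image) auto
  with a b \<open>a \<le> c\<close> \<open>c \<le> b\<close> show ?thesis
    by (meson connectedD_interval)
qed

lemma less_G_inverse_iff:
  assumes "t \<in> T" "c \<in> G_range t" "0 < r"
  shows "r < G_inverse c t \<longleftrightarrow> G t r < c"
  using G_less_iff[of t r "G_inverse c t"] G_inverse[OF assms(2)] assms by simp

lemma G_inverse_less_iff:
  assumes "t \<in> T" "c \<in> G_range t" "0 < r"
  shows "G_inverse c t < r \<longleftrightarrow> c < G t r"
  using G_less_iff[of t "G_inverse c t" r] G_inverse[OF assms(2)] assms by simp

lemma G_inverse_strict_mono:
  assumes "t \<in> T" "c \<in> G_range t" "d \<in> G_range t" "c < d"
  shows "G_inverse c t < G_inverse d t"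
  using G_inverse_less_iff[of t c "G_inverse d t"] G_inverse[OF assms(3)] assms by simp

text \<open>
  By monotonicity, \<open>r < G_inverse c t\<close> and \<open>G_inverse c t < r\<close> amount to \<open>G t r < c\<close> and \<open>c < G t r\<close>.
  For fixed \<open>r\<close> these are open conditions on \<open>(c, t)\<close>.
\<close>
lemma G_inverse_continuous:
  assumes C: "\<And>c t. c \<in> C \<Longrightarrow> t \<in> T \<Longrightarrow> c \<in> G_range t"
  shows "continuous_on (C \<times> T) (\<lambda>(c, t). G_inverse c t)"
  unfolding continuous_on_def
proof
  fix z assume "z \<in> C \<times> T"
  then obtain c t where z: "z = (c, t)" and c: "c \<in> C" and t: "t \<in> T"
    by auto
  let ?at = "at (c, t) within C \<times> T"
  have in_dom: "\<forall>\<^sub>F z in ?at. z \<in> C \<times> T"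
    by (simp add: eventually_at_filter)
  have fst_at: "(fst \<longlongrightarrow> c) ?at"
    using tendsto_fst[OF tendsto_ident_at, of "(c, t)"] by simp
  have G_at: "((\<lambda>z. G (snd z) r) \<longlongrightarrow> G t r) ?at" if "0 < r" for r
  proof -
    have "continuous_on (C \<times> T) (\<lambda>z. G (snd z) r)"
      using that by (intro G_compose_continuous continuous_intros) auto
    then show ?thesis using c t unfolding continuous_on_def by force
  qed
  have diff_at: "((\<lambda>z. G (snd z) r - fst z) \<longlongrightarrow> G t r - c) ?at" if "0 < r" for r
    by (intro tendsto_diff G_at fst_at that)
  have "((\<lambda>(c, t). G_inverse c t) \<longlongrightarrow> G_inverse c t) ?at"
  proof (rule order_tendstoI)
    fix a assume a: "a < G_inverse c t"
    \<comment> \<open>The bound \<open>a\<close> may be nonpositive, where \<open>G\<close> carries no information; it is raised to a positive one.\<close>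
    define r where "r = max a (G_inverse c t / 2)"
    have r: "a \<le> r" "0 < r" "r < G_inverse c t"
      using a G_inverse_pos[OF C[OF c t]] by (auto simp: r_def)
    then have "\<forall>\<^sub>F z in ?at. G (snd z) r - fst z < 0"
      using less_G_inverse_iff[OF t C[OF c t]] by (intro order_tendstoD(2)[OF diff_at]) auto
    with in_dom show "\<forall>\<^sub>F z in ?at. a < (\<lambda>(c, t). G_inverse c t) z"
    proof eventually_elim
      case (elim z)
      then show ?case using r C[of "fst z" "snd z"] less_G_inverse_iff[of "snd z" "fst z" r] by (cases z) auto
    qed
  next
    fix a assume a: "G_inverse c t < a"
    then have pos: "0 < a" using G_inverse_pos[OF C[OF c t]] by simp
    with a have "\<forall>\<^sub>F z in ?at. 0 < G (snd z) a - fst z"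
      using G_inverse_less_iff[OF t C[OF c t]] by (intro order_tendstoD(1)[OF diff_at]) auto
    with in_dom show "\<forall>\<^sub>F z in ?at. (\<lambda>(c, t). G_inverse c t) z < a"
    proof eventually_elim
      case (elim z)
      then show ?case using pos C[of "fst z" "snd z"] G_inverse_less_iff[of "snd z" "fst z" a] by (cases z) auto
    qed
  qed
  then show "((\<lambda>(c, t). G_inverse c t) \<longlongrightarrow> (\<lambda>(c, t). G_inverse c t) z) (at z within C \<times> T)"
    by (simp add: z)
qed

lemma G_inverse_continuous_param:
  assumes "\<And>t. t \<in> T \<Longrightarrow> c \<in> G_range t"
  shows "continuous_on T (G_inverse c)"
  by (rule continuous_on_compose_Pair[OF G_inverse_continuous[of "{c}"]
        continuous_on_const continuous_on_id])
     (use assms in auto)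

end

section \<open>Minimizing over densities of mass one\<close>

locale strictly_convex_path = strictly_convex_family F G "{0..1}"
  for F G :: "real \<Rightarrow> real \<Rightarrow> real"
begin

text \<open>
  Such a \<open>c\<close> is the Lagrange multiplier for the constraint that the density have mass one.
\<close>
definition unit_level :: "real \<Rightarrow> bool" where
  "unit_level c \<longleftrightarrow> (\<forall>t\<in>{0..1}. c \<in> G_range t) \<and> (G_inverse c has_integral 1) {0..1}"

text \<open>
  At the least value \<open>a\<close> of \<open>G t 1\<close> over \<open>t\<close>, the inverse \<open>G_inverse a\<close> is at most one everywhere, and at
  the greatest value \<open>b\<close> it is at least one. Both values are attained, so each lies in some range and
  therefore, the ranges being equal, in all of them. The mass of \<open>G_inverse c\<close> depends continuously on
  \<open>c\<close> and passes through one in between.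
\<close>
lemma unit_level_exists:
  assumes same: "\<And>s t. s \<in> {0..1} \<Longrightarrow> t \<in> {0..1} \<Longrightarrow> G_range s = G_range t"
  shows "\<exists>c. unit_level c"
proof -
  have cont: "continuous_on {0..1} (\<lambda>t. G t 1)"
    by (intro G_compose_continuous continuous_intros) auto
  obtain t0 where t0: "t0 \<in> {0..1}" "\<And>t. t \<in> {0..1} \<Longrightarrow> G t0 1 \<le> G t 1"
    using continuous_attains_inf[OF compact_Icc _ cont] by fastforce
  obtain t1 where t1: "t1 \<in> {0..1}" "\<And>t. t \<in> {0..1} \<Longrightarrow> G t 1 \<le> G t1 1"
    using continuous_attains_sup[OF compact_Icc _ cont] by fastforce
  define a where "a = G t0 1"
  define b where "b = G t1 1"
  have ab: "a \<in> G_range t" "b \<in> G_range t" if "t \<in> {0..1}" for t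
  proof -
    have "a \<in> G_range t0" "b \<in> G_range t1"
      unfolding a_def b_def G_range_def by auto
    then show "a \<in> G_range t" "b \<in> G_range t"
      using same t0(1) t1(1) that by blast+
  qed
  have range: "c \<in> G_range t" if "c \<in> {a..b}" "t \<in> {0..1}" for c t
    using G_range_interval[of t a b c] ab that by auto
  have "a \<le> b" using t0 t1 unfolding a_def b_def by blast
  have integrable: "G_inverse c integrable_on {0..1}" if "c \<in> {a..b}" for c
    using range that by (intro integrable_continuous_real G_inverse_continuous_param) auto
  have "continuous_on {a..b} (\<lambda>c. integral (cbox 0 1) (G_inverse c))"
    by (rule integral_continuous_on_param)
       (use G_inverse_continuous[of "{a..b}"] range in auto)
  moreover have "integral {0..1} (G_inverse a) \<le> integral {0..1} (\<lambda>_::real. 1::real)"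
  proof (rule integral_le)
    fix t :: real assume t: "t \<in> {0..1}"
    show "G_inverse a t \<le> 1"
      using less_G_inverse_iff[OF t ab(1)[OF t], of 1] t0(2)[OF t] by (force simp: a_def)
  qed (use integrable \<open>a \<le> b\<close> in auto)
  moreover have "integral {0..1} (\<lambda>_::real. 1::real) \<le> integral {0..1} (G_inverse b)"
  proof (rule integral_le)
    fix t :: real assume t: "t \<in> {0..1}"
    show "1 \<le> G_inverse b t"
      using G_inverse_less_iff[OF t ab(2)[OF t], of 1] t1(2)[OF t] by (force simp: b_def)
  qed (use integrable \<open>a \<le> b\<close> in auto)
  ultimately obtain c where c: "a \<le> c" "c \<le> b" "integral {0..1} (G_inverse c) = 1"
    using IVT'[of "\<lambda>c. integral {0..1} (G_inverse c)" a 1 b] \<open>a \<le> b\<close> by auto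
  then have "unit_level c"
    unfolding unit_level_def using range integrable by (auto simp: has_integral_integrable_integral)
  then show ?thesis ..
qed

lemma unit_level_unique:
  assumes "unit_level c" "unit_level d"
  shows "c = d"
proof -
  have False if less: "c < d" and c: "unit_level c" and d: "unit_level d" for c d
  proof -
    have "integral {0..1} (G_inverse c) < integral {0..1} (G_inverse d)"
      using c d less unfolding unit_level_def
      by (intro integral_less_real G_inverse_continuous_param G_inverse_strict_mono) auto
    moreover have "integral {0..1} (G_inverse c) = 1" "integral {0..1} (G_inverse d) = 1"
      using c d unfolding unit_level_def by (auto intro: integral_unique)
    ultimately show False by simp
  qed
  with assms show ?thesis by (metis linorder_neqE)
qed

lemma F_density_integrable:
  assumes "continuous_on {0..1} p" "\<And>t. t \<in> {0..1} \<Longrightarrow> 0 < p t"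
  shows "(\<lambda>t. F t (p t)) integrable_on {0..1}"
  using assms by (intro integrable_continuous_real F_compose_continuous continuous_intros)

text \<open>
  The tangent of \<open>F t\<close> at \<open>G_inverse c t\<close> has slope \<open>c\<close>, the same for all \<open>t\<close>.
  Hence the linear terms of the tangent inequalities sum up to \<open>c\<close> times the difference of the two
  masses, which vanishes.
\<close>
lemma unit_level_minimizes:
  assumes c: "unit_level c"
    and p: "continuous_on {0..1} p" "\<And>t. t \<in> {0..1} \<Longrightarrow> 0 < p t" "integral {0..1} p = 1"
  shows "integral {0..1} (\<lambda>t. F t (G_inverse c t)) \<le> integral {0..1} (\<lambda>t. F t (p t))"
proof -
  have range: "\<And>t. t \<in> {0..1} \<Longrightarrow> c \<in> G_range t" and int_f: "(G_inverse c has_integral 1) {0..1}"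
    using c by (auto simp: unit_level_def)
  have F_f: "(\<lambda>t. F t (G_inverse c t)) integrable_on {0..1}"
    by (intro F_density_integrable G_inverse_continuous_param G_inverse_pos range)
  have "(p has_integral 1) {0..1}"
    using p by (simp add: has_integral_integrable_integral integrable_continuous_real)
  then have diff: "((\<lambda>t. c * (p t - G_inverse c t)) has_integral c * (1 - 1)) {0..1}"
    by (intro has_integral_mult_right has_integral_diff int_f)
  have "((\<lambda>t. F t (G_inverse c t) + c * (p t - G_inverse c t)) has_integral
      integral {0..1} (\<lambda>t. F t (G_inverse c t)) + c * (1 - 1)) {0..1}"
    by (intro has_integral_add integrable_integral F_f diff)
  then have "integral {0..1} (\<lambda>t. F t (G_inverse c t)) + c * (1 - 1) \<le> integral {0..1} (\<lambda>t. F t (p t))"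
    using integrable_integral[OF F_density_integrable[OF p(1,2)]]
  proof (rule has_integral_le)
    fix t :: real assume t: "t \<in> {0..1}"
    show "F t (G_inverse c t) + c * (p t - G_inverse c t) \<le> F t (p t)"
      using above_tangent[OF t G_inverse_pos[OF range[OF t]] p(2)[OF t]] G_G_inverse[OF range[OF t]]
      by simp
  qed
  then show ?thesis by simp
qed

text \<open>
  A polynomial uniformly close to \<open>f\<close> has mass close to one. Adding the missing mass as a constant
  keeps it close to \<open>f\<close>, and therefore positive because \<open>f\<close> is bounded away from zero. On the compact
  strip around the graph of \<open>f\<close>, uniform continuity of \<open>F\<close> controls the integrals.
\<close>
lemma polynomial_density_approximates:
  assumes f: "continuous_on {0..1} f" "\<And>t. t \<in> {0..1} \<Longrightarrow> 0 < f t" "integral {0..1} f = 1" and "0 < e"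
  obtains p where "real_polynomial_function p" "\<And>t. t \<in> {0..1} \<Longrightarrow> 0 < p t" "integral {0..1} p = 1"
    "integral {0..1} (\<lambda>t. F t (p t)) < integral {0..1} (\<lambda>t. F t (f t)) + e"
proof -
  obtain t0 where t0: "t0 \<in> {0..1}" "\<And>t. t \<in> {0..1} \<Longrightarrow> f t0 \<le> f t"
    using continuous_attains_inf[OF compact_Icc _ f(1)] by fastforce
  obtain t1 where t1: "t1 \<in> {0..1}" "\<And>t. t \<in> {0..1} \<Longrightarrow> f t \<le> f t1"
    using continuous_attains_sup[OF compact_Icc _ f(1)] by fastforce
  \<comment> \<open>Densities within distance \<open>m\<close> of \<open>f\<close> stay in \<open>{m..f t1 + m}\<close>, away from the boundary point zero.\<close>
  define m where "m = f t0 / 2"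
  have "0 < m" using f(2) t0(1) by (simp add: m_def)
  let ?K = "{m..f t1 + m} \<times> {0..1}"
  have "continuous_on ?K (\<lambda>(r, t). F t r)"
    by (rule continuous_on_subset[OF F_continuous]) (use \<open>0 < m\<close> in auto)
  then have "uniformly_continuous_on ?K (\<lambda>(r, t). F t r)"
    by (intro compact_uniformly_continuous compact_Times compact_Icc)
  then obtain d where "0 < d" and
    d: "\<And>z z'. z \<in> ?K \<Longrightarrow> z' \<in> ?K \<Longrightarrow> dist z' z < d \<Longrightarrow> dist ((\<lambda>(r, t). F t r) z') ((\<lambda>(r, t). F t r) z) < e / 2"
    using half_gt_zero[OF \<open>0 < e\<close>] unfolding uniformly_continuous_on_def by meson
  \<comment> \<open>Half the tolerance goes into the approximation and half into the correction of the mass.\<close>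
  define \<delta> where "\<delta> = min d m / 2"
  have \<delta>: "0 < \<delta>" "2 * \<delta> \<le> m" "2 * \<delta> \<le> d"
    using \<open>0 < d\<close> \<open>0 < m\<close> by (auto simp: \<delta>_def)
  obtain q where q: "real_polynomial_function q" "\<And>t. t \<in> {0..1} \<Longrightarrow> \<bar>f t - q t\<bar> < \<delta>"
    by (rule Stone_Weierstrass_real_polynomial_function[OF compact_Icc f(1) \<delta>(1)]) blast
  have cont_q: "continuous_on {0..1} q"
    using q(1) by (intro continuous_on_polymonial_function) (simp add: real_polynomial_function_eq)
  have int_q: "\<bar>1 - integral {0..1} q\<bar> < \<delta>"
  proof -
    have q': "f t - \<delta> < q t" "q t < f t + \<delta>" if "t \<in> {0..1}" for t
      using q(2)[OF that] by linarith+
    have "integral {0..1} q < integral {0..1} (\<lambda>t. f t + \<delta>)"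
      by (intro integral_less_real continuous_intros cont_q f) (use q' in auto)
    moreover have "integral {0..1} (\<lambda>t. f t - \<delta>) < integral {0..1} q"
      by (intro integral_less_real continuous_intros cont_q f) (use q' in auto)
    moreover have "integral {0..1} (\<lambda>t. f t + \<delta>) = 1 + \<delta>" "integral {0..1} (\<lambda>t. f t - \<delta>) = 1 - \<delta>"
      using f(3) integrable_continuous_real[OF f(1)]
      by (simp_all add: Henstock_Kurzweil_Integration.integral_add Henstock_Kurzweil_Integration.integral_diff
          integrable_const_ivl)
    ultimately show ?thesis
      by linarith
  qed
  define p where "p = (\<lambda>t. q t + (1 - integral {0..1} q))"
  have close: "\<bar>f t - p t\<bar> < 2 * \<delta>" if "t \<in> {0..1}" for t
    using q(2)[OF that] int_q by (simp add: p_def)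
  have p_ge: "m < p t" "p t < f t1 + m" if "t \<in> {0..1}" for t
    using close[OF that] t0(2)[OF that] t1(2)[OF that] \<delta>(2) by (auto simp: m_def)
  show thesis
  proof (rule that)
    show "real_polynomial_function p"
      unfolding p_def by (intro real_polynomial_function.intros q(1))
    show pos: "0 < p t" if "t \<in> {0..1}" for t
      using p_ge(1)[OF that] \<open>0 < m\<close> by simp
    show "integral {0..1} p = 1"
      unfolding p_def using cont_q by (simp add: integral_add integrable_continuous_real)
    have cont_p: "continuous_on {0..1} p"
      unfolding p_def by (intro continuous_intros cont_q)
    have "integral {0..1} (\<lambda>t. F t (p t)) \<le> integral {0..1} (\<lambda>t. F t (f t) + e / 2)"
    proof (rule integral_le)
      fix t :: real assume t: "t \<in> {0..1}"
      have "(f t, t) \<in> ?K" "(p t, t) \<in> ?K"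
        using t p_ge[OF t] t0(2)[OF t] t1(2)[OF t] \<open>0 < m\<close> by (auto simp: m_def)
      moreover have "dist (p t, t) (f t, t) < d"
        using close[OF t] \<delta>(3) by (simp add: dist_Pair_Pair dist_real_def abs_minus_commute)
      ultimately have "dist (F t (p t)) (F t (f t)) < e / 2"
        using d[of "(f t, t)" "(p t, t)"] by simp
      then show "F t (p t) \<le> F t (f t) + e / 2"
        unfolding dist_real_def by linarith
    next
      show "(\<lambda>t. F t (p t)) integrable_on {0..1}"
        by (rule F_density_integrable[OF cont_p pos])
      show "(\<lambda>t. F t (f t) + e / 2) integrable_on {0..1}"
        by (intro integrable_add F_density_integrable[OF f(1,2)] integrable_const_ivl)
    qed
    also have "\<dots> = integral {0..1} (\<lambda>t. F t (f t)) + e / 2"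
      using F_density_integrable[OF f(1,2)]
      by (simp add: Henstock_Kurzweil_Integration.integral_add integrable_const_ivl)
    finally show "integral {0..1} (\<lambda>t. F t (p t)) < integral {0..1} (\<lambda>t. F t (f t)) + e"
      using \<open>0 < e\<close> by simp
  qed
qed

end

section \<open>Changes of variables\<close>

lemma has_vector_derivative_velocity:
  assumes "(u has_vector_derivative v) (at t within {0..1})" "t \<in> {0..1}"
  shows "velocity u t = v"
  using vector_derivative_within_cbox[of 0 1 t u v] assms by simp

lemma smooth_on_velocity:
  assumes "smooth_on {0..1} u"
  shows smooth_on_has_velocity: "\<And>t. t \<in> {0..1} \<Longrightarrow> (u has_vector_derivative velocity u t) (at t within {0..1})"
    and smooth_on_velocity_continuous: "continuous_on {0..1} (velocity u)"
proof -
  obtain D where D0: "\<And>t. t \<in> {0..1} \<Longrightarrow> D 0 t = u t"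
    and D: "\<And>n t. t \<in> {0..1} \<Longrightarrow> (D n has_vector_derivative D (Suc n) t) (at t within {0..1})"
    using assms unfolding smooth_on_def by blast
  have u: "(u has_vector_derivative D 1 t) (at t within {0..1})" if "t \<in> {0..1}" for t
    using has_vector_derivative_transform[OF that _ D[OF that, of 0], of u] D0 by simp
  then have eq: "velocity u t = D 1 t" if "t \<in> {0..1}" for t
    using has_vector_derivative_velocity that by blast
  with u show "\<And>t. t \<in> {0..1} \<Longrightarrow> (u has_vector_derivative velocity u t) (at t within {0..1})"
    by simp
  have "continuous_on {0..1} (D 1)"
    using D[of _ 1] by (intro continuous_on_vector_derivative) auto
  with eq show "continuous_on {0..1} (velocity u)"
    using continuous_on_cong by (metis (no_types, lifting))
qed

text \<open>
  An inverse function rule for derivatives within a set, which covers the one-sided derivatives at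
  the endpoints of an interval: the difference quotient of \<open>\<psi>\<close> is the reciprocal of that of \<open>\<phi>\<close>, taken
  at points that tend to \<open>x\<close> by continuity of \<open>\<psi>\<close>.
\<close>
lemma inverse_has_derivative_within:
  fixes \<phi> \<psi> :: "real \<Rightarrow> real"
  assumes deriv: "(\<phi> has_real_derivative d) (at x within S)" and "d \<noteq> 0" and "x \<in> S"
    and inv: "\<And>y. y \<in> \<phi> ` S \<Longrightarrow> \<psi> y \<in> S \<and> \<phi> (\<psi> y) = y" "\<psi> (\<phi> x) = x"
    and cont: "continuous_on (\<phi> ` S) \<psi>"
  shows "(\<psi> has_real_derivative 1 / d) (at (\<phi> x) within \<phi> ` S)"
proof -
  have ev: "\<forall>\<^sub>F y in at (\<phi> x) within \<phi> ` S. y \<in> \<phi> ` S \<and> y \<noteq> \<phi> x"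
    by (simp add: eventually_at_filter)
  have "(\<psi> \<longlongrightarrow> x) (at (\<phi> x) within \<phi> ` S)"
    using cont inv(2) \<open>x \<in> S\<close> unfolding continuous_on_def by force
  then have "filterlim \<psi> (at x within S) (at (\<phi> x) within \<phi> ` S)"
    unfolding filterlim_at using ev inv by (auto elim!: eventually_mono)
  then have "((\<lambda>y. (\<phi> (\<psi> y) - \<phi> x) / (\<psi> y - x)) \<longlongrightarrow> d) (at (\<phi> x) within \<phi> ` S)"
    by (rule filterlim_compose[OF deriv[unfolded has_field_derivative_iff]])
  then have "((\<lambda>y. 1 / ((\<phi> (\<psi> y) - \<phi> x) / (\<psi> y - x))) \<longlongrightarrow> 1 / d) (at (\<phi> x) within \<phi> ` S)"
    using \<open>d \<noteq> 0\<close> by (intro tendsto_intros) auto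
  then have "((\<lambda>y. (\<psi> y - \<psi> (\<phi> x)) / (y - \<phi> x)) \<longlongrightarrow> 1 / d) (at (\<phi> x) within \<phi> ` S)"
    by (rule Lim_transform_eventually) (use ev in eventually_elim, use inv in auto)
  then show ?thesis unfolding has_field_derivative_iff .
qed

lemma change_of_variables_inverse:
  assumes \<phi>: "\<phi> \<in> changes_of_variables"
  defines "\<psi> \<equiv> inv_into {0..1} \<phi>"
  shows "\<phi> ` {0..1} = {0..1}" "\<And>t. t \<in> {0..1} \<Longrightarrow> \<psi> (\<phi> t) = t" "continuous_on {0..1} \<psi>"
    "\<And>t. t \<in> {0..1} \<Longrightarrow> (\<psi> has_real_derivative 1 / velocity \<phi> t) (at (\<phi> t) within {0..1})"
proof -
  have smooth: "smooth_on {0..1} \<phi>" and \<phi>01: "\<phi> 0 = 0" "\<phi> 1 = 1" "\<phi> ` {0..1} \<subseteq> {0..1}"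
    and pos: "\<And>t. t \<in> {0..1} \<Longrightarrow> 0 < velocity \<phi> t"
    using \<phi> by (auto simp: changes_of_variables_def)
  have deriv: "(\<phi> has_real_derivative velocity \<phi> t) (at t within {0..1})" if "t \<in> {0..1}" for t
    using smooth_on_has_velocity[OF smooth that]
    by (simp add: has_real_derivative_iff_has_vector_derivative)
  then have cont: "continuous_on {0..1} \<phi>"
    by (rule DERIV_continuous_on)
  have less: "\<phi> s < \<phi> t" if "0 \<le> s" "s < t" "t \<le> 1" for s t
  proof (rule DERIV_pos_imp_increasing_open[OF \<open>s < t\<close>])
    fix x assume "s < x" "x < t"
    then have "x \<in> {0<..<1}" "x \<in> {0..1}" using that by auto
    then have "(\<phi> has_real_derivative velocity \<phi> x) (at x)"
      using has_field_derivative_subset[OF deriv, of x "{0<..<1}"]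
      by (simp add: at_within_open[of x "{0<..<1}"] subset_eq)
    then show "\<exists>y. DERIV \<phi> x :> y \<and> 0 < y" using pos \<open>x \<in> {0..1}\<close> by blast
  qed (rule continuous_on_subset[OF cont], use that in auto)
  have inj: "inj_on \<phi> {0..1}"
    using less by (metis atLeastAtMost_iff linorder_inj_onI' less_irrefl)
  show img: "\<phi> ` {0..1} = {0..1}"
  proof
    show "{0..1} \<subseteq> \<phi> ` {0..1}"
    proof
      fix y :: real assume "y \<in> {0..1}"
      then obtain t where "0 \<le> t" "t \<le> 1" "\<phi> t = y"
        using IVT'[of \<phi> 0 y 1] cont \<phi>01 by auto
      then show "y \<in> \<phi> ` {0..1}" by auto
    qed
  qed (rule \<phi>01(3))
  show inv: "\<psi> (\<phi> t) = t" if "t \<in> {0..1}" for t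
    using inj that by (simp add: \<psi>_def)
  have inv': "\<psi> y \<in> {0..1} \<and> \<phi> (\<psi> y) = y" if "y \<in> \<phi> ` {0..1}" for y
    using that inv_into_into[OF that] f_inv_into_f[OF that] by (simp add: \<psi>_def)
  show cont': "continuous_on {0..1} \<psi>"
    using continuous_on_inv[OF cont compact_Icc, of \<psi>] inv img by simp
  show "(\<psi> has_real_derivative 1 / velocity \<phi> t) (at (\<phi> t) within {0..1})" if "t \<in> {0..1}" for t
    using inverse_has_derivative_within[OF deriv[OF that] _ that, of \<psi>] pos[OF that] inv' inv[OF that] cont' img
    by simp
qed

text \<open>
  By the chain rule, \<open>u\<^sub>\<phi>\<close> has velocity \<open>u'(t) / \<phi>'(t)\<close> at \<open>s = \<phi>(t)\<close>; the factor \<open>\<phi>'(t)\<close> from \<open>ds\<close> completes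
  the integrand to the section of \<open>W\<close>.
\<close>
lemma functional_I_reparametrized:
  assumes W: "continuous_on UNIV W" and u: "smooth_on {0..1} u" and \<phi>: "\<phi> \<in> changes_of_variables"
  shows "functional_I W (reparametrized u \<phi>) =
    integral {0..1} (\<lambda>t. radial_section W (velocity u t) (velocity \<phi> t))"
proof -
  define \<psi> where "\<psi> = inv_into {0..1} \<phi>"
  note inv = change_of_variables_inverse[OF \<phi>, folded \<psi>_def]
  have smooth: "smooth_on {0..1} \<phi>" and \<phi>01: "\<phi> 0 = 0" "\<phi> 1 = 1"
    and pos: "\<And>t. t \<in> {0..1} \<Longrightarrow> 0 < velocity \<phi> t"
    using \<phi> by (auto simp: changes_of_variables_def)
  have \<psi>_in: "\<psi> s \<in> {0..1}" "\<phi> (\<psi> s) = s" if "s \<in> {0..1}" for s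
  proof -
    have "s \<in> \<phi> ` {0..1}" using that inv(1) by simp
    then show "\<psi> s \<in> {0..1}" "\<phi> (\<psi> s) = s"
      unfolding \<psi>_def by (rule inv_into_into, rule f_inv_into_f)
  qed
  have vel: "velocity (reparametrized u \<phi>) s = (1 / velocity \<phi> (\<psi> s)) *\<^sub>R velocity u (\<psi> s)"
    if s: "s \<in> {0..1}" for s
  proof (rule has_vector_derivative_velocity[OF _ s])
    have "(\<psi> has_vector_derivative 1 / velocity \<phi> (\<psi> s)) (at s within {0..1})"
      using inv(4)[OF \<psi>_in(1)[OF s]] \<psi>_in(2)[OF s]
      by (simp add: has_real_derivative_iff_has_vector_derivative)
    moreover have "(u has_vector_derivative velocity u (\<psi> s)) (at (\<psi> s) within \<psi> ` {0..1})"
      by (rule has_vector_derivative_within_subset[OF smooth_on_has_velocity[OF u \<psi>_in(1)[OF s]]])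
         (use \<psi>_in in auto)
    ultimately have "(u \<circ> \<psi> has_vector_derivative (1 / velocity \<phi> (\<psi> s)) *\<^sub>R velocity u (\<psi> s))
        (at s within {0..1})"
      by (rule vector_diff_chain_within)
    then show "(reparametrized u \<phi> has_vector_derivative (1 / velocity \<phi> (\<psi> s)) *\<^sub>R velocity u (\<psi> s))
        (at s within {0..1})"
      by (simp add: reparametrized_def[abs_def] \<psi>_def comp_def)
  qed
  define w where "w = (\<lambda>s. W ((1 / velocity \<phi> (\<psi> s)) *\<^sub>R velocity u (\<psi> s)))"
  have "continuous_on {0..1} w"
    unfolding w_def
    by (intro continuous_on_compose2[OF W] continuous_intros
        continuous_on_compose2[OF smooth_on_velocity_continuous[OF smooth] inv(3)]
        continuous_on_compose2[OF smooth_on_velocity_continuous[OF u] inv(3)])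
       (use \<psi>_in pos in \<open>auto simp: less_imp_neq[THEN not_sym]\<close>)
  then have "((\<lambda>t. velocity \<phi> t *\<^sub>R w (\<phi> t)) has_integral integral {\<phi> 0..\<phi> 1} w) {0..1}"
    using smooth_on_has_velocity[OF smooth] inv(1) \<phi>01
    by (intro has_integral_substitution[where c = 0 and d = 1])
       (auto simp: has_real_derivative_iff_has_vector_derivative)
  then have "integral {0..1} w = integral {0..1} (\<lambda>t. velocity \<phi> t *\<^sub>R w (\<phi> t))"
    using \<phi>01 by (simp add: integral_unique)
  moreover have "functional_I W (reparametrized u \<phi>) = integral {0..1} w"
    unfolding functional_I_def w_def by (rule integral_cong) (simp add: vel)
  moreover have "integral {0..1} (\<lambda>t. velocity \<phi> t *\<^sub>R w (\<phi> t)) =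
      integral {0..1} (\<lambda>t. radial_section W (velocity u t) (velocity \<phi> t))"
    by (rule integral_cong) (simp add: w_def inv(2) radial_section_def)
  ultimately show ?thesis by simp
qed

lemma velocity_change_of_variables:
  assumes \<phi>: "\<phi> \<in> changes_of_variables"
  shows "integral {0..1} (velocity \<phi>) = 1"
proof -
  have "(velocity \<phi> has_integral \<phi> 1 - \<phi> 0) {0..1}"
    using \<phi> by (intro fundamental_theorem_of_calculus smooth_on_has_velocity) (auto simp: changes_of_variables_def)
  then show ?thesis using \<phi> by (auto simp: changes_of_variables_def integral_unique)
qed

text \<open>
  Polynomials can be differentiated indefinitely within their own class, which yields the whole
  sequence of derivatives of \<open>P\<close> after the first.
\<close>
lemma smooth_on_antiderivative_polynomial:
  assumes p: "real_polynomial_function p"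
    and P: "\<And>t. t \<in> S \<Longrightarrow> (P has_vector_derivative p t) (at t within S)"
  shows "smooth_on S P"
proof -
  have "\<exists>d. \<forall>n. (real_polynomial_function (d n) \<and> (n = 0 \<longrightarrow> d n = p)) \<and>
      (\<forall>x. (d n has_real_derivative d (Suc n) x) (at x))"
  proof (rule dependent_nat_choice)
    fix d :: "real \<Rightarrow> real" and n :: nat
    assume "real_polynomial_function d \<and> (n = 0 \<longrightarrow> d = p)"
    then obtain d' where "real_polynomial_function d'" "\<forall>x. (d has_real_derivative d' x) (at x)"
      using has_real_derivative_polynomial_function by blast
    then show "\<exists>d'. (real_polynomial_function d' \<and> (Suc n = 0 \<longrightarrow> d' = p)) \<and>
        (\<forall>x. (d has_real_derivative d' x) (at x))"
      by blast
  qed (use p in auto)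
  then obtain d where d: "d 0 = p" "\<And>n x. (d n has_real_derivative d (Suc n) x) (at x)"
    by blast
  show ?thesis
    unfolding smooth_on_def
  proof (intro exI[of _ "\<lambda>n. case n of 0 \<Rightarrow> P | Suc k \<Rightarrow> d k"] conjI allI ballI)
    fix n t assume t: "t \<in> S"
    show "((case n of 0 \<Rightarrow> P | Suc k \<Rightarrow> d k) has_vector_derivative
        (case Suc n of 0 \<Rightarrow> P | Suc k \<Rightarrow> d k) t) (at t within S)"
      using P[OF t] d has_vector_derivative_at_within
      by (cases n) (auto simp flip: has_real_derivative_iff_has_vector_derivative
          intro: has_field_derivative_at_within)
  qed simp
qed

lemma change_of_variables_from_density:
  assumes p: "real_polynomial_function p" and pos: "\<And>t. t \<in> {0..1} \<Longrightarrow> 0 < p t" and int: "integral {0..1} p = 1"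
  obtains \<phi> where "\<phi> \<in> changes_of_variables" "\<And>t. t \<in> {0..1} \<Longrightarrow> velocity \<phi> t = p t"
proof
  define \<phi> where "\<phi> = (\<lambda>t. integral {0..t} p)"
  have cont: "continuous_on A p" for A
    using p by (intro continuous_on_polymonial_function) (simp add: real_polynomial_function_eq)
  have deriv: "(\<phi> has_vector_derivative p t) (at t within {0..1})" if "t \<in> {0..1}" for t
    unfolding \<phi>_def by (rule integral_has_vector_derivative[OF cont that])
  show vel: "velocity \<phi> t = p t" if "t \<in> {0..1}" for t
    by (rule has_vector_derivative_velocity[OF deriv[OF that] that])
  have "\<phi> t \<in> {0..1}" if t: "t \<in> {0..1}" for t
  proof -
    have "0 \<le> integral {0..t} p"
      using pos t by (intro integral_nonneg integrable_continuous_real cont) (auto simp: less_imp_le)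
    moreover have "integral {0..t} p \<le> integral {0..1} p"
      using pos t by (intro integral_subset_le integrable_continuous_real cont) (auto simp: less_imp_le)
    ultimately show ?thesis using int by (simp add: \<phi>_def)
  qed
  then show "\<phi> \<in> changes_of_variables"
    unfolding changes_of_variables_def
    using smooth_on_antiderivative_polynomial[OF p deriv] vel pos int by (auto simp: \<phi>_def)
qed

section \<open>The invariant realization\<close>

lemma strictly_convex_path_velocity:
  assumes W: "radially_strictly_convex_smooth W" and u: "smooth_regular_curve u"
  shows "strictly_convex_path (\<lambda>t. radial_section W (velocity u t)) (\<lambda>t r. g_map W r (velocity u t))"
proof
  have "continuous_on UNIV W" using W by (simp add: radially_strictly_convex_smooth_def)
  moreover have "continuous_on ({0<..} \<times> {0..1}) (\<lambda>z. velocity u (snd z))"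
    by (rule continuous_on_compose2[OF smooth_on_velocity_continuous continuous_on_snd[OF continuous_on_id]])
       (use u in \<open>auto simp: smooth_regular_curve_def\<close>)
  then have "continuous_on ({0::real<..} \<times> {0..1}) (\<lambda>z. (1 / fst z) *\<^sub>R velocity u (snd z))"
    by (intro continuous_intros) auto
  ultimately have "continuous_on ({0::real<..} \<times> {0..1}) (\<lambda>z. W ((1 / fst z) *\<^sub>R velocity u (snd z)))"
    by (rule continuous_on_compose2) simp
  then have "continuous_on ({0::real<..} \<times> {0..1})
      (\<lambda>z. fst z * W ((1 / fst z) *\<^sub>R velocity u (snd z)))"
    by (intro continuous_on_mult continuous_on_fst continuous_on_id)
  then show "continuous_on ({0<..} \<times> {0..1}) (\<lambda>(r, t). radial_section W (velocity u t) r)"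
    by (simp add: radial_section_def split_def)
  fix t :: real assume t: "t \<in> {0..1}"
  then have nz: "velocity u t \<noteq> 0" using u by (simp add: smooth_regular_curve_def)
  then show "strictly_convex_on {0<..} (radial_section W (velocity u t))"
    using W by (simp add: radially_strictly_convex_smooth_def)
  fix r :: real assume "0 < r"
  with nz show "(radial_section W (velocity u t) has_real_derivative g_map W r (velocity u t)) (at r)"
    by (rule g_map_is_derivative_of_section[OF W])
qed

theorem theorem3p1:
  fixes W :: "real ^ 'm \<Rightarrow> real" and u :: "real \<Rightarrow> real ^ 'm"
  assumes "radially_strictly_convex_smooth W"
    and "smooth_regular_curve u"
  shows "((\<forall>s\<in>{0..1}. \<forall>t\<in>{0..1}. f_domain W (velocity u s) = f_domain W (velocity u t))
            \<longrightarrow> (\<exists>c. c_condition W u c))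
       \<and> ((\<exists>c. c_condition W u c)
            \<longrightarrow> (\<exists>!c. c_condition W u c)
              \<and> invariant_realization W u =
                  ereal (integral {0..1} (\<lambda>t. f_map W (c_of W u) (velocity u t) *
                    W ((1 / f_map W (c_of W u) (velocity u t)) *\<^sub>R velocity u t))))"
proof -
  interpret strictly_convex_path "\<lambda>t. radial_section W (velocity u t)" "\<lambda>t r. g_map W r (velocity u t)"
    by (rule strictly_convex_path_velocity[OF assms])
  have range_eq: "G_range t = f_domain W (velocity u t)" for t
    by (simp add: G_range_def f_domain_def)
  have inverse_eq: "G_inverse c t = f_map W c (velocity u t)" for c t
    by (simp add: G_inverse_def f_map_def)
  have level_eq: "unit_level c \<longleftrightarrow> c_condition W u c" for c
    by (simp add: unit_level_def c_condition_def range_eq inverse_eq[abs_def])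
  have W: "continuous_on UNIV W" and u: "smooth_on {0..1} u"
    using assms by (auto simp: radially_strictly_convex_smooth_def smooth_regular_curve_def)
  have exists: "\<exists>c. c_condition W u c"
    if "\<forall>s\<in>{0..1}. \<forall>t\<in>{0..1}. f_domain W (velocity u s) = f_domain W (velocity u t)"
  proof -
    have "\<exists>c. unit_level c"
      by (rule unit_level_exists) (unfold range_eq, rule that[rule_format])
    then show ?thesis unfolding level_eq .
  qed
  have infimum: "(\<exists>!c. c_condition W u c) \<and> invariant_realization W u =
      ereal (integral {0..1} (\<lambda>t. f_map W (c_of W u) (velocity u t) *
        W ((1 / f_map W (c_of W u) (velocity u t)) *\<^sub>R velocity u t)))"
    if ex: "\<exists>c. c_condition W u c"
  proof
    show ex1: "\<exists>!c. c_condition W u c"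
      using ex unit_level_unique unfolding level_eq by blast
    define c where "c = c_of W u"
    have c: "unit_level c"
      unfolding level_eq c_def c_of_def using theI'[OF ex1] .
    define f where "f = G_inverse c"
    have f: "continuous_on {0..1} f" "\<And>t. t \<in> {0..1} \<Longrightarrow> 0 < f t" "integral {0..1} f = 1"
      using c unfolding unit_level_def f_def
      by (blast intro: G_inverse_continuous_param G_inverse_pos integral_unique)+
    define J where "J = integral {0..1} (\<lambda>t. radial_section W (velocity u t) (f t))"
    have "invariant_realization W u = ereal J"
      unfolding invariant_realization_def
    proof (rule antisym)
      show "ereal J \<le> (INF \<phi>\<in>changes_of_variables. ereal (functional_I W (reparametrized u \<phi>)))"
      proof (rule INF_greatest)
        fix \<phi> :: "real \<Rightarrow> real" assume \<phi>: "\<phi> \<in> changes_of_variables"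
        have "J \<le> integral {0..1} (\<lambda>t. radial_section W (velocity u t) (velocity \<phi> t))"
          unfolding J_def f_def
        proof (rule unit_level_minimizes[OF c])
          show "continuous_on {0..1} (velocity \<phi>)"
            using \<phi> by (intro smooth_on_velocity_continuous) (simp add: changes_of_variables_def)
          show "0 < velocity \<phi> t" if "t \<in> {0..1}" for t
            using \<phi> that by (simp add: changes_of_variables_def)
          show "integral {0..1} (velocity \<phi>) = 1"
            by (rule velocity_change_of_variables[OF \<phi>])
        qed
        then show "ereal J \<le> ereal (functional_I W (reparametrized u \<phi>))"
          by (simp add: functional_I_reparametrized[OF W u \<phi>])
      qed
      show "(INF \<phi>\<in>changes_of_variables. ereal (functional_I W (reparametrized u \<phi>))) \<le> ereal J"
      proof (rule ereal_le_epsilon2)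
        fix e :: real assume "0 < e"
        obtain p where p: "real_polynomial_function p" "\<And>t. t \<in> {0..1} \<Longrightarrow> 0 < p t"
            "integral {0..1} p = 1"
            "integral {0..1} (\<lambda>t. radial_section W (velocity u t) (p t)) < J + e"
          using polynomial_density_approximates[OF f \<open>0 < e\<close>] unfolding J_def by blast
        obtain \<phi> where \<phi>: "\<phi> \<in> changes_of_variables" "\<And>t. t \<in> {0..1} \<Longrightarrow> velocity \<phi> t = p t"
          using change_of_variables_from_density[OF p(1-3)] by blast
        have "functional_I W (reparametrized u \<phi>) =
            integral {0..1} (\<lambda>t. radial_section W (velocity u t) (p t))"
          unfolding functional_I_reparametrized[OF W u \<phi>(1)]
          by (rule integral_cong) (simp add: \<phi>(2))
        with p(4) have "ereal (functional_I W (reparametrized u \<phi>)) \<le> ereal J + ereal e"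
          by simp
        then show "(INF \<phi>\<in>changes_of_variables. ereal (functional_I W (reparametrized u \<phi>)))
            \<le> ereal J + ereal e"
          by (rule INF_lower2[OF \<phi>(1)])
      qed
    qed
    then show "invariant_realization W u =
      ereal (integral {0..1} (\<lambda>t. f_map W (c_of W u) (velocity u t) *
        W ((1 / f_map W (c_of W u) (velocity u t)) *\<^sub>R velocity u t)))"
      by (simp add: J_def f_def c_def inverse_eq radial_section_def)
  qed
  show ?thesis using exists infimum by blast
qed

end
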